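(* Let $n\ge1$ and $f\in L^2(\mathbb R^n)$. The quantity $$\frac{d_\alpha}{C_\alpha}\int_{\mathbb R^n}|x|^{-\alpha}\Big|\,\big(|x|^{-n+\frac\alpha2}*f\big)(x)\Big|^2dx,$$ where $$C_\alpha=\pi^\alpha\left[\frac{\Gamma(\frac{n-\alpha}4)}{\Gamma(\frac{n+\alpha}4)}\right]^2,\qquad d_\alpha=\pi^{-(n-\alpha)}\left[\frac{\Gamma(\frac{2n-\alpha}4)}{\Gamma(\frac\alpha4)}\right]^2,$$ is monotone decreasing (non-increasing) as a function of $\alpha$ for $0<\alpha<\min\{2,n\}$.
   Context: Here $|x|^{-n+\alpha/2}*f$ denotes the convolution $\int_{\mathbb R^n}|x-y|^{-n+\alpha/2}f(y)\,dy$. *)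

theory Defs
  imports "HOL-Analysis.Analysis"
begin

text \<open>Members of the space of square-integrable functions are given by arbitrary
  Lebesgue-measurable, complex-valued representatives.\<close>

definition square_integrable :: "(real^'n \<Rightarrow> complex) \<Rightarrow> bool" where
  "square_integrable f \<longleftrightarrow>
     f \<in> borel_measurable lebesgue \<and> integrable lebesgue (\<lambda>x. (norm (f x))\<^sup>2)"

text \<open>Since \<open>0 powr a = 0\<close>, the kernels \<open>norm x powr a\<close> below vanish, rather than being
  infinite, at the origin; a single point does not affect any of the integrals.\<close>

definition convolution :: "(real^'n \<Rightarrow> real) \<Rightarrow> (real^'n \<Rightarrow> complex) \<Rightarrow> real^'n \<Rightarrow> complex" where
  "convolution k f x = (LINT y|lebesgue. of_real (k (x - y)) * f y)"

definition C_const :: "nat \<Rightarrow> real \<Rightarrow> real" where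
  "C_const n \<alpha> = pi powr \<alpha> * (Gamma ((real n - \<alpha>) / 4) / Gamma ((real n + \<alpha>) / 4))\<^sup>2"

definition d_const :: "nat \<Rightarrow> real \<Rightarrow> real" where
  "d_const n \<alpha> = pi powr (- (real n - \<alpha>)) *
     (Gamma ((2 * real n - \<alpha>) / 4) / Gamma (\<alpha> / 4))\<^sup>2"

text \<open>The outer integrand is nonnegative, so its integral is taken in \<open>[0, \<infinity>]\<close>: divergence
  is then recorded as \<open>\<infinity>\<close> and not as the default value 0 of the Bochner integral.\<close>

definition pitt_quantity :: "(real^'n \<Rightarrow> complex) \<Rightarrow> real \<Rightarrow> ennreal" where
  "pitt_quantity f \<alpha> =
     ennreal (d_const CARD('n) \<alpha> / C_const CARD('n) \<alpha>) *
     (\<integral>\<^sup>+ x. ennreal (norm x powr (- \<alpha>) *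
        (norm (convolution (\<lambda>z. norm z powr (- real CARD('n) + \<alpha> / 2)) f x))\<^sup>2) \<partial>lebesgue)"

end

theory Submission
  imports Defs "HOL-Probability.Distributions"
begin

text \<open>
  Let \<open>n\<close> be the dimension and let \<open>riesz a x = r a * norm x powr (a - n)\<close> be the Riesz kernel, with its constant
  \<open>r a\<close> chosen such that \<open>riesz a * riesz b = riesz (a + b)\<close> under convolution
  (\<open>riesz_convolution\<close>). Then \<open>d_const n \<alpha> = (r (\<alpha> / 2))^2\<close> and
  \<open>C_const n \<alpha> = (r ((n + \<alpha>) / 2))^2\<close>, so that with \<open>N \<alpha> = norm (riesz (\<alpha> / 2) * f)\<close> the quantity in question is
  \<open>(r ((n + \<alpha>) / 2))^(-2)\<close> times the integral of \<open>norm x powr (- \<alpha>) * (N \<alpha> x)^2\<close>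
  (\<open>pitt_quantity_eq\<close>).

  For \<open>\<alpha> < \<beta>\<close> the semigroup law gives the pointwise bound \<open>N \<beta> \<le> riesz ((\<beta> - \<alpha>) / 2) * N \<alpha>\<close>
  (\<open>riesz_potential_domination\<close>). Monotonicity thus reduces to a
  norm bound for the single positive operator \<open>g \<mapsto> riesz ((\<beta> - \<alpha>) / 2) * g\<close> between two weighted
  \<open>L\<^sup>2\<close> spaces. Up to the weights its kernel is homogeneous of degree \<open>- n\<close>, and the
  Schur test with the critical power \<open>norm y powr (- n / 2)\<close> bounds the square of its norm by
  \<open>(r ((n + \<beta>) / 2) / r ((n + \<alpha>) / 2))^2\<close> (\<open>stein_weiss_bound\<close>). This is precisely
  \<open>C_const n \<beta> / C_const n \<alpha>\<close>, which compensates the change of the normalising constants.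

  The semigroup law with its exact constant is obtained by writing the Riesz kernels as superpositions
  of Gaussians, for which convolution is addition of the time parameters
  (\<open>heat_convolution\<close>).
\<close>

section \<open>The Gaussian semigroup\<close>

text \<open>The parameter is chosen so that every kernel has total mass one without further constants;
  \<open>heat u\<close> is the usual heat kernel at time \<open>u / (4 * pi)\<close>.\<close>

definition heat :: "real \<Rightarrow> 'a::euclidean_space \<Rightarrow> real" where
  "heat u x = u powr (- real DIM('a) / 2) * exp (- (pi * (norm x)\<^sup>2 / u))"

lemma heat_nonneg [simp]: "0 \<le> heat u x"
  by (simp add: heat_def)

lemma heat_measurable [measurable]:
  "(\<lambda>(u, x). heat u x) \<in> borel_measurable (borel \<Otimes>\<^sub>M (borel :: 'a::euclidean_space measure))"
  unfolding heat_def by measurable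

lemma nn_integral_exp_square:
  assumes "c > 0"
  shows "(\<integral>\<^sup>+x. ennreal (exp (- (c * x\<^sup>2))) \<partial>lborel) = ennreal (sqrt (pi / c))"
proof -
  define s where "s = sqrt (1 / (2 * c))"
  have s: "s > 0" "s\<^sup>2 = 1 / (2 * c)"
    using assms by (auto simp: s_def)
  have "exp (- (c * x\<^sup>2)) = sqrt (pi / c) * normal_density 0 s x" for x
    using assms s by (simp add: normal_density_def real_sqrt_divide real_sqrt_mult mult.commute)
  then have "(\<integral>\<^sup>+x. ennreal (exp (- (c * x\<^sup>2))) \<partial>lborel)
      = (\<integral>\<^sup>+x. ennreal (sqrt (pi / c)) * ennreal (normal_density 0 s x) \<partial>lborel)"
    using assms by (simp add: ennreal_mult)
  also have "\<dots> = ennreal (sqrt (pi / c)) * (\<integral>\<^sup>+x. ennreal (normal_density 0 s x) \<partial>lborel)"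
    by (rule nn_integral_cmult) simp
  also have "(\<integral>\<^sup>+x. ennreal (normal_density 0 s x) \<partial>lborel) = 1"
    using s by (subst nn_integral_eq_integral)
      (auto intro: integrable_normal_density simp: integral_normal_density)
  finally show ?thesis by simp
qed

lemma nn_integral_translate:
  fixes f :: "'a::euclidean_space \<Rightarrow> ennreal"
  assumes [measurable]: "f \<in> borel_measurable borel"
  shows "(\<integral>\<^sup>+x. f (c + x) \<partial>lborel) = (\<integral>\<^sup>+x. f x \<partial>lborel)"
proof -
  have "(\<integral>\<^sup>+x. f x \<partial>lborel) = (\<integral>\<^sup>+x. f x \<partial>distr lborel borel ((+) c))"
    by (simp add: lborel_distr_plus)
  also have "\<dots> = (\<integral>\<^sup>+x. f (c + x) \<partial>lborel)"
    by (rule nn_integral_distr) auto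
  finally show ?thesis by simp
qed

lemma nn_integral_gaussian:
  fixes m :: "'a::euclidean_space"
  assumes "c > 0"
  shows "(\<integral>\<^sup>+x. ennreal (exp (- (c * (norm (x - m))\<^sup>2))) \<partial>lborel)
           = ennreal ((pi / c) powr (real DIM('a) / 2))"
proof -
  have "(\<integral>\<^sup>+x. ennreal (exp (- (c * (norm (x - m))\<^sup>2))) \<partial>lborel)
      = (\<integral>\<^sup>+x. ennreal (exp (- (c * (norm (x::'a))\<^sup>2))) \<partial>lborel)"
    using nn_integral_translate[of "\<lambda>x::'a. ennreal (exp (- (c * (norm x)\<^sup>2)))" "- m"]
    by (simp add: algebra_simps)
  also have "\<dots> = (\<integral>\<^sup>+x. (\<Prod>b\<in>Basis. ennreal (exp (- (c * ((x::'a) \<bullet> b)\<^sup>2)))) \<partial>lborel)"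
    by (intro nn_integral_cong)
      (simp add: prod_ennreal euclidean_inner[of x x for x] sum_distrib_left sum_negf
        power2_norm_eq_inner flip: exp_sum power2_eq_square)
  also have "\<dots> = (\<Prod>b\<in>(Basis::'a set). (\<integral>\<^sup>+x. ennreal (exp (- (c * x\<^sup>2))) \<partial>lborel))"
    by (rule nn_integral_lborel_prod) auto
  also have "\<dots> = ennreal (sqrt (pi / c)) ^ DIM('a)"
    by (simp add: nn_integral_exp_square[OF assms])
  also have "\<dots> = ennreal ((pi / c) powr (real DIM('a) / 2))"
    using assms
    by (simp add: ennreal_power powr_half_sqrt[symmetric] powr_powr flip: powr_realpow)
  finally show ?thesis .
qed

text \<open>Completing the square: with \<open>m = v / (u + v) * x\<close>, the exponent
  \<open>norm (x - y)^2 / u + norm y ^ 2 / v\<close> splits into \<open>norm x ^ 2 / (u + v)\<close>, which is independent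
  of \<open>y\<close>, and a multiple of \<open>norm (y - m)^2\<close>.\<close>

lemma heat_convolution:
  fixes x :: "'a::euclidean_space"
  assumes "u > 0" "v > 0"
  shows "(\<integral>\<^sup>+y. ennreal (heat u (x - y) * heat v y) \<partial>lborel) = ennreal (heat (u + v) x)"
proof -
  define n where "n = real DIM('a)"
  define c where "c = pi * (u + v) / (u * v)"
  define m where "m = (v / (u + v)) *\<^sub>R x"
  define K where "K = (u * v) powr (- n / 2) * exp (- (pi * (norm x)\<^sup>2 / (u + v)))"
  have c: "c > 0" using assms by (simp add: c_def)
  have sq: "pi * (norm (x - y))\<^sup>2 / u + pi * (norm y)\<^sup>2 / v
          = pi * (norm x)\<^sup>2 / (u + v) + c * (norm (y - m))\<^sup>2" for y
  proof -
    define X Y Z where "X = x \<bullet> x" and "Y = y \<bullet> y" and "Z = x \<bullet> y"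
    have 1: "(norm (x - y))\<^sup>2 = X - 2 * Z + Y" "(norm y)\<^sup>2 = Y" "(norm x)\<^sup>2 = X"
      "(norm (y - m))\<^sup>2 = Y - 2 * (v / (u + v)) * Z + (v / (u + v))\<^sup>2 * X"
      by (simp_all add: X_def Y_def Z_def m_def power2_norm_eq_inner inner_diff_left inner_diff_right
          inner_commute[of y x] algebra_simps power2_eq_square[of "v / (u + v)"])
    have "u + v \<noteq> 0" "u \<noteq> 0" "v \<noteq> 0" using assms by auto
    then have "(X - 2 * Z + Y) / u + Y / v
        = X / (u + v) + (u + v) / (u * v) * (Y - 2 * (v / (u + v)) * Z + (v / (u + v))\<^sup>2 * X)"
      by (simp add: divide_simps power2_eq_square) (simp add: algebra_simps)
    from arg_cong[OF this, of "(*) pi"] show ?thesis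
      by (simp only: 1 c_def) (simp add: algebra_simps)
  qed
  have "heat u (x - y) * heat v y = K * exp (- (c * (norm (y - m))\<^sup>2))" for y
  proof -
    have "heat u (x - y) * heat v y
        = (u * v) powr (- n / 2) * exp (- (pi * (norm (x - y))\<^sup>2 / u + pi * (norm y)\<^sup>2 / v))"
      using assms by (simp add: heat_def n_def powr_mult exp_add[symmetric] exp_diff exp_minus field_simps)
    also have "\<dots> = K * exp (- (c * (norm (y - m))\<^sup>2))"
      unfolding sq K_def minus_add_distrib exp_add by (simp add: mult.assoc)
    finally show ?thesis .
  qed
  then have "(\<integral>\<^sup>+y. ennreal (heat u (x - y) * heat v y) \<partial>lborel)
      = ennreal K * (\<integral>\<^sup>+y. ennreal (exp (- (c * (norm (y - m))\<^sup>2))) \<partial>lborel)"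
    by (subst nn_integral_cmult[symmetric]) (auto simp: K_def ennreal_mult)
  also have "\<dots> = ennreal (K * (pi / c) powr (n / 2))"
    using c by (simp add: nn_integral_gaussian n_def K_def ennreal_mult)
  also have "K * (pi / c) powr (n / 2) = heat (u + v) x"
  proof -
    have "pi / c = (u * v) / (u + v)" using assms by (simp add: c_def)
    moreover have "(u * v) powr (- n / 2) * (u * v / (u + v)) powr (n / 2) = (u + v) powr (- n / 2)"
      using assms by (simp add: powr_divide powr_mult powr_minus field_simps)
    ultimately show ?thesis
      by (simp add: K_def heat_def n_def mult_ac)
  qed
  finally show ?thesis .
qed

section \<open>Gamma and Beta integrals\<close>

text \<open>Euler's integral for \<open>Gamma p\<close> under the inversion \<open>t = c / u\<close>. In this form the time variable
  of the Gaussians is integrated out.\<close>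

lemma nn_integral_inverse_gamma:
  assumes p: "p > 0" and c: "c > 0"
  shows "(\<integral>\<^sup>+u\<in>{0<..}. ennreal (u powr (- p - 1) * exp (- (c / u))) \<partial>lborel)
           = ennreal (Gamma p * c powr (- p))"
proof -
  define f where "f = (\<lambda>t::real. t powr (p - 1) / exp t)"
  define g where "g = (\<lambda>u::real. c / u)"
  have im: "g ` {0<..} = {0<..}"
  proof (intro equalityI subsetI)
    fix t :: real assume "t \<in> {0<..}"
    then have "t = g (c / t)" "c / t \<in> {0<..}" using c by (auto simp: g_def)
    then show "t \<in> g ` {0<..}" by blast
  qed (use c in \<open>auto simp: g_def\<close>)
  have "(f has_integral Gamma p) {0<..}"
  proof (rule has_integral_spike_set_eq[THEN iffD1])
    show "(f has_integral Gamma p) {0..}"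
      unfolding f_def by (rule Gamma_integral_real[OF p])
  qed (rule negligible_subset[of "{0}"]; auto)+
  then have "f absolutely_integrable_on (g ` {0<..}) \<and> integral (g ` {0<..}) f = Gamma p"
    unfolding im by (auto simp: has_integral_iff f_def intro!: nonnegative_absolutely_integrable_1)
  then have "(\<lambda>u. \<bar>- c / u\<^sup>2\<bar> * f (g u)) absolutely_integrable_on {0<..} \<and>
             integral {0<..} (\<lambda>u. \<bar>- c / u\<^sup>2\<bar> * f (g u)) = Gamma p"
    using c by (subst has_absolute_integral_change_of_variables_1')
      (auto simp: g_def inj_on_def power2_eq_square intro!: derivative_eq_intros)
  then have "((\<lambda>u. \<bar>- c / u\<^sup>2\<bar> * f (g u)) has_integral Gamma p) {0<..}"
    by (auto simp: has_integral_iff set_lebesgue_integral_eq_integral)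
  also have "\<bar>- c / u\<^sup>2\<bar> * f (g u) = c powr p * (u powr (- p - 1) * exp (- (c / u)))"
    if "u \<in> {0<..}" for u
  proof -
    have "c / u\<^sup>2 * (c / u) powr (p - 1) = c powr p * u powr (- p - 1)"
      using that c
      by (simp add: powr_divide powr_diff powr_minus power2_eq_square field_simps)
    then show ?thesis using c by (simp add: f_def g_def exp_minus field_simps)
  qed
  ultimately have "((\<lambda>u. c powr p * (u powr (- p - 1) * exp (- (c / u)))) has_integral Gamma p) {0<..}"
    using has_integral_cong by (metis (no_types, lifting))
  then have "((\<lambda>u. c powr (- p) * (c powr p * (u powr (- p - 1) * exp (- (c / u)))))
      has_integral c powr (- p) * Gamma p) {0<..}"
    by (rule has_integral_mult_right)
  moreover have "c powr (- p) * (c powr p * z) = z" for z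
    using c by (simp add: powr_minus field_simps)
  ultimately have "((\<lambda>u. u powr (- p - 1) * exp (- (c / u))) has_integral Gamma p * c powr (- p)) {0<..}"
    by (simp add: mult.commute)
  from nn_integral_has_integral_lebesgue[OF _ this] show ?thesis
    by (auto simp: ennreal_mult' ennreal_indicator mult.commute)
qed

lemma nn_integral_beta_scaled:
  assumes p: "p > 0" and q: "q > 0" and w: "w > 0"
  shows "(\<integral>\<^sup>+u\<in>{0<..<w}. ennreal (u powr (p - 1) * (w - u) powr (q - 1)) \<partial>lborel)
           = ennreal (Beta p q * w powr (p + q - 1))"
proof -
  have "((\<lambda>t. t powr (p - 1) * (1 - t) powr (q - 1)) has_integral Beta p q) {0<..<1}"
    using has_integral_Beta_real[OF p q] by (simp add: has_integral_Icc_iff_Ioo)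
  from nn_integral_has_integral_lebesgue[OF _ this]
  have B: "(\<integral>\<^sup>+t\<in>{0<..<1}. ennreal (t powr (p - 1) * (1 - t) powr (q - 1)) \<partial>lborel) = ennreal (Beta p q)"
    by (auto simp: ennreal_mult' ennreal_indicator mult.commute)
  have "(\<integral>\<^sup>+u\<in>{0<..<w}. ennreal (u powr (p - 1) * (w - u) powr (q - 1)) \<partial>lborel)
     = ennreal w * (\<integral>\<^sup>+t. ennreal ((0 + w * t) powr (p - 1) * (w - (0 + w * t)) powr (q - 1))
          * indicator {0<..<w} (0 + w * t) \<partial>lborel)"
    using w by (subst nn_integral_real_affine[of _ w 0]) auto
  also have "\<dots> = ennreal w * (\<integral>\<^sup>+t. ennreal (w powr (p + q - 2)) *
      (ennreal (t powr (p - 1) * (1 - t) powr (q - 1)) * indicator {0<..<1} t) \<partial>lborel)"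
  proof (intro arg_cong[of _ _ "(*) (ennreal w)"] nn_integral_cong)
    fix t :: real
    have "(w * t) powr (p - 1) * (w - w * t) powr (q - 1)
        = w powr (p + q - 2) * (t powr (p - 1) * (1 - t) powr (q - 1))" if "0 < t" "t < 1"
    proof -
      have "w - w * t = w * (1 - t)" by (simp add: algebra_simps)
      moreover have "w powr (p + q - 2) = w powr (p - 1) * w powr (q - 1)"
        by (simp flip: powr_add)
      ultimately show ?thesis using that w by (simp add: powr_mult)
    qed
    then show "ennreal ((0 + w * t) powr (p - 1) * (w - (0 + w * t)) powr (q - 1))
          * indicator {0<..<w} (0 + w * t) = ennreal (w powr (p + q - 2)) *
      (ennreal (t powr (p - 1) * (1 - t) powr (q - 1)) * indicator {0<..<1} t)"
      using w by (auto simp: indicator_def zero_less_mult_iff simp flip: ennreal_mult')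
  qed
  also have "\<dots> = ennreal w * (ennreal (w powr (p + q - 2)) * ennreal (Beta p q))"
    by (subst nn_integral_cmult) (auto simp: B)
  also have "\<dots> = ennreal (w * w powr (p + q - 2) * Beta p q)"
    using w p q by (simp add: mult.assoc Beta_def flip: ennreal_mult')
  also have "w * w powr (p + q - 2) = w powr (p + q - 1)"
    using w powr_add[of w 1 "p + q - 2"] by simp
  finally show ?thesis by (simp add: mult.commute)
qed

text \<open>The powers \<open>u powr (p - 1)\<close> on the half-line are convolved here: for fixed \<open>w = u + v\<close> the
  remaining integral over \<open>u\<close> is a scaled Beta integral. The function \<open>F\<close> will be the Gaussian at a
  fixed point as a function of time.\<close>

lemma nn_integral_beta_sum:
  fixes F :: "real \<Rightarrow> ennreal"
  assumes p: "p > 0" and q: "q > 0" and [measurable]: "F \<in> borel_measurable borel"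
  shows "(\<integral>\<^sup>+u\<in>{0<..}. \<integral>\<^sup>+v\<in>{0<..}. F (u + v) * ennreal (u powr (p - 1) * v powr (q - 1)) \<partial>lborel \<partial>lborel)
           = ennreal (Beta p q) * (\<integral>\<^sup>+w\<in>{0<..}. F w * ennreal (w powr (p + q - 1)) \<partial>lborel)"
proof -
  let ?k = "\<lambda>u w. F w * ennreal (u powr (p - 1) * (w - u) powr (q - 1))
                  * indicator {0<..} u * indicator {0<..} (w - u)"
  have "(\<integral>\<^sup>+u\<in>{0<..}. \<integral>\<^sup>+v\<in>{0<..}. F (u + v) * ennreal (u powr (p - 1) * v powr (q - 1)) \<partial>lborel \<partial>lborel)
      = (\<integral>\<^sup>+u. \<integral>\<^sup>+v. ?k u (u + v) \<partial>lborel \<partial>lborel)"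
    by (intro nn_integral_cong, subst nn_integral_multc[symmetric]) (auto simp: mult_ac)
  also have "\<dots> = (\<integral>\<^sup>+u. \<integral>\<^sup>+w. ?k u w \<partial>lborel \<partial>lborel)"
    by (intro nn_integral_cong nn_integral_translate) measurable
  also have "\<dots> = (\<integral>\<^sup>+w. \<integral>\<^sup>+u. ?k u w \<partial>lborel \<partial>lborel)"
    by (rule lborel_pair.Fubini') measurable
  also have "\<dots> = (\<integral>\<^sup>+w. ennreal (Beta p q) * (F w * ennreal (w powr (p + q - 1)) * indicator {0<..} w) \<partial>lborel)"
  proof (intro nn_integral_cong)
    fix w :: real
    have "(\<integral>\<^sup>+u. ?k u w \<partial>lborel)
        = (\<integral>\<^sup>+u. F w * (ennreal (u powr (p - 1) * (w - u) powr (q - 1)) * indicator {0<..<w} u) \<partial>lborel)"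
      by (intro nn_integral_cong) (auto simp: indicator_def)
    also have "\<dots> = F w * (\<integral>\<^sup>+u\<in>{0<..<w}. ennreal (u powr (p - 1) * (w - u) powr (q - 1)) \<partial>lborel)"
      by (rule nn_integral_cmult) measurable
    also have "\<dots> = ennreal (Beta p q) * (F w * ennreal (w powr (p + q - 1)) * indicator {0<..} w)"
    proof (cases "w > 0")
      case True
      then show ?thesis
        unfolding nn_integral_beta_scaled[OF p q True]
        using p q by (simp add: ennreal_mult'' mult_ac)
    qed simp
    finally show "(\<integral>\<^sup>+u. ?k u w \<partial>lborel) =
        ennreal (Beta p q) * (F w * ennreal (w powr (p + q - 1)) * indicator {0<..} w)" .
  qed
  also have "\<dots> = ennreal (Beta p q) * (\<integral>\<^sup>+w\<in>{0<..}. F w * ennreal (w powr (p + q - 1)) \<partial>lborel)"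
    by (rule nn_integral_cmult) measurable
  finally show ?thesis .
qed

section \<open>Riesz kernels\<close>

text \<open>With this constant the Fourier transform of \<open>riesz a\<close>, for \<open>0 < a < n\<close>, is \<open>norm \<xi> powr (- a)\<close> (in the convention
  \<open>exp (- 2 * pi * \<i> * (x \<bullet> \<xi>))\<close>), which is why orders add under convolution. Both
  \<open>C_const\<close> and \<open>d_const\<close> are squares of its values.\<close>

definition riesz_const :: "nat \<Rightarrow> real \<Rightarrow> real" where
  "riesz_const n a = pi powr (a - real n / 2) * Gamma ((real n - a) / 2) / Gamma (a / 2)"

definition riesz :: "real \<Rightarrow> 'a::euclidean_space \<Rightarrow> real" where
  "riesz a x = riesz_const DIM('a) a * norm x powr (a - real DIM('a))"

lemma riesz_const_pos: "0 < a \<Longrightarrow> a < real n \<Longrightarrow> 0 < riesz_const n a"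
  by (simp add: riesz_const_def Gamma_real_pos)

text \<open>The reflection \<open>a \<mapsto> n - a\<close> exchanges the two Gamma values.\<close>

lemma riesz_const_reflect:
  assumes "0 < a" "a < real n"
  shows "riesz_const n (real n - a) * riesz_const n a = 1"
proof -
  have "pi powr (real n - a - real n / 2) * pi powr (a - real n / 2) = 1"
    by (simp flip: powr_add)
  moreover have "Gamma (a / 2) > 0" "Gamma ((real n - a) / 2) > 0"
    using assms by (auto intro!: Gamma_real_pos)
  ultimately show ?thesis
    by (simp add: riesz_const_def field_simps)
qed

lemma riesz_nonneg [simp]: "0 < a \<Longrightarrow> a < real DIM('a) \<Longrightarrow> 0 \<le> riesz a (x::'a::euclidean_space)"
  using riesz_const_pos[of a "DIM('a)"] by (simp add: riesz_def)

lemma riesz_minus [simp]: "riesz a (- x) = riesz a x"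
  by (simp add: riesz_def)

lemma riesz_measurable [measurable]: "riesz a \<in> borel_measurable borel"
  unfolding riesz_def by measurable

text \<open>Subordination: up to a power of \<open>pi\<close>, convolution with \<open>riesz a\<close> is the power \<open>- a / 2\<close> of the
  (negative) generator of the Gaussian semigroup. At the origin it fails, since there \<open>0 powr (a - n) = 0\<close> while the integral is
  infinite.\<close>

lemma riesz_eq_heat_integral:
  fixes x :: "'a::euclidean_space"
  assumes a: "0 < a" "a < real DIM('a)" and x: "x \<noteq> 0"
  shows "ennreal (riesz a x) = ennreal (pi powr (a / 2) / Gamma (a / 2)) *
           (\<integral>\<^sup>+u\<in>{0<..}. ennreal (heat u x * u powr (a / 2 - 1)) \<partial>lborel)"
proof -
  define n where "n = real DIM('a)"
  define p where "p = (n - a) / 2"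
  define c where "c = pi * (norm x)\<^sup>2"
  have p: "p > 0" and c: "c > 0" using a x by (auto simp: p_def c_def n_def)
  have "heat u x * u powr (a / 2 - 1) = u powr (- p - 1) * exp (- (c / u))" for u
  proof -
    have "u powr (- n / 2) * u powr (a / 2 - 1) = u powr (- p - 1)"
      unfolding powr_add[symmetric] by (simp add: p_def diff_divide_distrib algebra_simps)
    then show ?thesis by (simp add: heat_def c_def n_def mult_ac)
  qed
  then have "(\<integral>\<^sup>+u\<in>{0<..}. ennreal (heat u x * u powr (a / 2 - 1)) \<partial>lborel)
      = ennreal (Gamma p * c powr (- p))"
    by (simp add: nn_integral_inverse_gamma[OF p c])
  moreover have "riesz a x = pi powr (a / 2) / Gamma (a / 2) * (Gamma p * c powr (- p))"
  proof -
    have "c powr (- p) = pi powr (- p) * norm x powr (a - n)"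
      using x by (simp add: c_def powr_mult powr_powr p_def diff_divide_distrib flip: powr_numeral)
    moreover have "pi powr (a / 2) * pi powr (- p) = pi powr (a - n / 2)"
      unfolding powr_add[symmetric] by (simp add: p_def diff_divide_distrib)
    ultimately show ?thesis
      by (simp add: riesz_def riesz_const_def n_def p_def)
  qed
  ultimately show ?thesis
    using a by (simp add: Gamma_real_pos less_imp_le flip: ennreal_mult')
qed

text \<open>Both kernels are subordinated to Gaussians. The convolution in space then only adds the two times,
  and the powers of the times combine by the Beta integral, whose Gamma values are exactly those
  of the subordination constants.\<close>

theorem riesz_convolution:
  fixes x :: "'a::euclidean_space"
  assumes a: "0 < a" and b: "0 < b" and ab: "a + b < real DIM('a)" and x: "x \<noteq> 0"
  shows "(\<integral>\<^sup>+y. ennreal (riesz a (x - y) * riesz b y) \<partial>lborel) = ennreal (riesz (a + b) x)"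
proof -
  define k where "k = (\<lambda>a::real. ennreal (pi powr (a / 2) / Gamma (a / 2)))"
  define h where "h = (\<lambda>a u (y::'a). ennreal (heat u y * u powr (a / 2 - 1)) * indicator {0<..} u)"
  have h_measurable [measurable]: "(\<lambda>(u, y). h a u y) \<in> borel_measurable (borel \<Otimes>\<^sub>M borel)" for a
    unfolding h_def by measurable
  have rep: "ennreal (riesz c y) = k c * (\<integral>\<^sup>+u. h c u y \<partial>lborel)"
    if "0 < c" "c < real DIM('a)" "y \<noteq> 0" for c and y :: 'a
    using riesz_eq_heat_integral[OF that] by (simp add: k_def h_def)
  have "(\<integral>\<^sup>+y. ennreal (riesz a (x - y) * riesz b y) \<partial>lborel)
      = (\<integral>\<^sup>+y. k a * k b * (\<integral>\<^sup>+u. \<integral>\<^sup>+v. h a u (x - y) * h b v y \<partial>lborel \<partial>lborel) \<partial>lborel)"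
  proof (rule nn_integral_cong_AE)
    show "AE y in lborel. ennreal (riesz a (x - y) * riesz b y)
        = k a * k b * (\<integral>\<^sup>+u. \<integral>\<^sup>+v. h a u (x - y) * h b v y \<partial>lborel \<partial>lborel)"
      using AE_lborel_singleton[of 0] AE_lborel_singleton[of x]
    proof eventually_elim
      case (elim y)
      have "ennreal (riesz a (x - y) * riesz b y)
          = k a * (\<integral>\<^sup>+u. h a u (x - y) \<partial>lborel) * (k b * (\<integral>\<^sup>+v. h b v y \<partial>lborel))"
        using a b ab elim by (simp add: ennreal_mult rep)
      then show ?case
        by (simp add: nn_integral_cmult nn_integral_multc mult_ac)
    qed
  qed
  also have "\<dots> = k a * k b * (\<integral>\<^sup>+y. \<integral>\<^sup>+u. \<integral>\<^sup>+v. h a u (x - y) * h b v y \<partial>lborel \<partial>lborel \<partial>lborel)"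
    by (rule nn_integral_cmult) measurable
  also have "(\<integral>\<^sup>+y. \<integral>\<^sup>+u. \<integral>\<^sup>+v. h a u (x - y) * h b v y \<partial>lborel \<partial>lborel \<partial>lborel)
      = (\<integral>\<^sup>+u. \<integral>\<^sup>+y. \<integral>\<^sup>+v. h a u (x - y) * h b v y \<partial>lborel \<partial>lborel \<partial>lborel)"
    by (rule lborel_pair.Fubini') measurable
  also have "\<dots> = (\<integral>\<^sup>+u. \<integral>\<^sup>+v. \<integral>\<^sup>+y. h a u (x - y) * h b v y \<partial>lborel \<partial>lborel \<partial>lborel)"
    by (intro nn_integral_cong lborel_pair.Fubini') measurable
  also have "\<dots> = (\<integral>\<^sup>+u\<in>{0<..}. \<integral>\<^sup>+v\<in>{0<..}. ennreal (heat (u + v) x) *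
      ennreal (u powr (a / 2 - 1) * v powr (b / 2 - 1)) \<partial>lborel \<partial>lborel)"
  proof (intro nn_integral_cong)
    fix u :: real
    have "(\<integral>\<^sup>+y. h a u (x - y) * h b v y \<partial>lborel) = ennreal (heat (u + v) x) *
        ennreal (u powr (a / 2 - 1) * v powr (b / 2 - 1)) * indicator {0<..} v" if "u > 0" for v
    proof (cases "v > 0")
      case True
      have "(\<integral>\<^sup>+y. h a u (x - y) * h b v y \<partial>lborel) = (\<integral>\<^sup>+y. ennreal (heat u (x - y) * heat v y) *
          ennreal (u powr (a / 2 - 1) * v powr (b / 2 - 1)) \<partial>lborel)"
        using that True by (intro nn_integral_cong) (simp add: h_def ennreal_mult mult_ac)
      also have "\<dots> = ennreal (heat (u + v) x) * ennreal (u powr (a / 2 - 1) * v powr (b / 2 - 1))"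
        by (subst nn_integral_multc) (auto simp: heat_convolution[OF that True])
      finally show ?thesis using True by simp
    qed (simp add: h_def)
    then show "(\<integral>\<^sup>+v. \<integral>\<^sup>+y. h a u (x - y) * h b v y \<partial>lborel \<partial>lborel) =
      (\<integral>\<^sup>+v\<in>{0<..}. ennreal (heat (u + v) x) *
          ennreal (u powr (a / 2 - 1) * v powr (b / 2 - 1)) \<partial>lborel) * indicator {0<..} u"
      by (cases "u > 0") (simp_all add: h_def)
  qed
  also have "\<dots> = ennreal (Beta (a / 2) (b / 2)) *
      (\<integral>\<^sup>+w\<in>{0<..}. ennreal (heat w x) * ennreal (w powr (a / 2 + b / 2 - 1)) \<partial>lborel)"
    using a b by (intro nn_integral_beta_sum) auto
  also have "(\<integral>\<^sup>+w\<in>{0<..}. ennreal (heat w x) * ennreal (w powr (a / 2 + b / 2 - 1)) \<partial>lborel)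
      = (\<integral>\<^sup>+w. h (a + b) w x \<partial>lborel)"
    by (simp add: h_def ennreal_mult add_divide_distrib)
  also have "k a * k b * (ennreal (Beta (a / 2) (b / 2)) * (\<integral>\<^sup>+w. h (a + b) w x \<partial>lborel))
      = k (a + b) * (\<integral>\<^sup>+w. h (a + b) w x \<partial>lborel)"
  proof -
    have Gamma_pos: "Gamma (c / 2) > 0" if "c > 0" for c :: real
      using that by (intro Gamma_real_pos) simp
    have "pi powr (a / 2) / Gamma (a / 2) * (pi powr (b / 2) / Gamma (b / 2)) * Beta (a / 2) (b / 2)
        = pi powr (a / 2) * pi powr (b / 2) / Gamma (a / 2 + b / 2)"
      using Gamma_pos[OF a] Gamma_pos[OF b] by (simp add: Beta_def)
    also have "\<dots> = pi powr ((a + b) / 2) / Gamma ((a + b) / 2)"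
      by (simp add: powr_add add_divide_distrib)
    finally have "k a * k b * ennreal (Beta (a / 2) (b / 2)) = k (a + b)"
      using Gamma_pos[OF a] Gamma_pos[OF b] by (simp add: k_def flip: ennreal_mult')
    then show ?thesis by (simp add: mult.assoc[symmetric])
  qed
  also have "\<dots> = ennreal (riesz (a + b) x)"
    using a b ab x by (simp add: rep)
  finally show ?thesis .
qed

section \<open>The weighted bound for Riesz kernels\<close>

text \<open>By the Cauchy--Schwarz inequality for the measure with density \<open>K x\<close>, applied to
  \<open>sqrt p * (g / sqrt p)\<close>, the square of the inner integral is at most \<open>s x\<close> times
  the integral of \<open>K x y * (g y)^2 / p y\<close>; then the order of integration is exchanged.\<close>

lemma schur_test:
  fixes K :: "'a \<Rightarrow> 'b \<Rightarrow> ennreal" and p :: "'b \<Rightarrow> real"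
  assumes "pair_sigma_finite M N"
  assumes K [measurable]: "(\<lambda>(x, y). K x y) \<in> borel_measurable (M \<Otimes>\<^sub>M N)"
    and [measurable]: "w \<in> borel_measurable M" "s \<in> borel_measurable M"
      "p \<in> borel_measurable N" "g \<in> borel_measurable N"
  assumes pos: "AE y in N. p y > 0"
    and row: "AE x in M. (\<integral>\<^sup>+y. K x y * ennreal (p y) \<partial>N) \<le> s x"
    and col: "AE y in N. (\<integral>\<^sup>+x. w x * s x * K x y \<partial>M) \<le> t y"
  shows "(\<integral>\<^sup>+x. w x * (\<integral>\<^sup>+y. K x y * g y \<partial>N)\<^sup>2 \<partial>M) \<le> (\<integral>\<^sup>+y. t y * ((g y)\<^sup>2 * ennreal (1 / p y)) \<partial>N)"
proof -
  interpret pair_sigma_finite M N by fact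
  let ?q = "\<lambda>y. (g y)\<^sup>2 * ennreal (1 / p y)"
  have cs: "(\<integral>\<^sup>+y. K x y * g y \<partial>N)\<^sup>2 \<le> (\<integral>\<^sup>+y. K x y * ennreal (p y) \<partial>N) * (\<integral>\<^sup>+y. K x y * ?q y \<partial>N)"
    if [measurable]: "x \<in> space M" for x
  proof -
    let ?f = "\<lambda>y. ennreal (sqrt (p y))" and ?h = "\<lambda>y. g y * ennreal (1 / sqrt (p y))"
    have "(\<integral>\<^sup>+y. K x y * g y \<partial>N) = (\<integral>\<^sup>+y. K x y * (?f y * ?h y) \<partial>N)"
    proof (rule nn_integral_cong_AE)
      show "AE y in N. K x y * g y = K x y * (?f y * ?h y)"
        using pos
      proof eventually_elim
        case (elim y)
        then have "?f y * ennreal (1 / sqrt (p y)) = 1"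
          by (simp flip: ennreal_mult')
        then show ?case by (simp add: mult.left_commute)
      qed
    qed
    also have "\<dots> = (\<integral>\<^sup>+y. ?f y * ?h y \<partial>density N (K x))"
      by (rule nn_integral_density[symmetric]) measurable
    also have "\<dots>\<^sup>2 \<le> (\<integral>\<^sup>+y. (?f y)\<^sup>2 \<partial>density N (K x)) * (\<integral>\<^sup>+y. (?h y)\<^sup>2 \<partial>density N (K x))"
      by (rule Cauchy_Schwarz_nn_integral) measurable
    also have "(\<integral>\<^sup>+y. (?f y)\<^sup>2 \<partial>density N (K x)) = (\<integral>\<^sup>+y. K x y * (?f y)\<^sup>2 \<partial>N)"
      by (rule nn_integral_density) measurable
    also have "\<dots> = (\<integral>\<^sup>+y. K x y * ennreal (p y) \<partial>N)"
      using pos by (intro nn_integral_cong_AE) (auto elim!: eventually_mono simp: ennreal_power)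
    also have "(\<integral>\<^sup>+y. (?h y)\<^sup>2 \<partial>density N (K x)) = (\<integral>\<^sup>+y. K x y * (?h y)\<^sup>2 \<partial>N)"
      by (rule nn_integral_density) measurable
    also have "\<dots> = (\<integral>\<^sup>+y. K x y * ?q y \<partial>N)"
      using pos by (intro nn_integral_cong_AE)
        (auto elim!: eventually_mono simp: ennreal_power power_mult_distrib power_divide)
    finally show ?thesis .
  qed
  have "(\<integral>\<^sup>+x. w x * (\<integral>\<^sup>+y. K x y * g y \<partial>N)\<^sup>2 \<partial>M) \<le> (\<integral>\<^sup>+x. w x * (s x * (\<integral>\<^sup>+y. K x y * ?q y \<partial>N)) \<partial>M)"
  proof (rule nn_integral_mono_AE)
    show "AE x in M. w x * (\<integral>\<^sup>+y. K x y * g y \<partial>N)\<^sup>2 \<le> w x * (s x * (\<integral>\<^sup>+y. K x y * ?q y \<partial>N))"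
      using row AE_space
    proof eventually_elim
      case (elim x)
      then show ?case
        by (intro mult_left_mono order_trans[OF cs] mult_right_mono) auto
    qed
  qed
  also have "\<dots> = (\<integral>\<^sup>+x. \<integral>\<^sup>+y. w x * s x * K x y * ?q y \<partial>N \<partial>M)"
    by (intro nn_integral_cong) (simp add: nn_integral_cmult[symmetric] mult.assoc)
  also have "\<dots> = (\<integral>\<^sup>+y. \<integral>\<^sup>+x. w x * s x * K x y * ?q y \<partial>M \<partial>N)"
    by (rule Fubini'[symmetric]) measurable
  also have "\<dots> = (\<integral>\<^sup>+y. (\<integral>\<^sup>+x. w x * s x * K x y \<partial>M) * ?q y \<partial>N)"
    by (intro nn_integral_cong nn_integral_multc) measurable
  also have "\<dots> \<le> (\<integral>\<^sup>+y. t y * ?q y \<partial>N)"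
    using col by (intro nn_integral_mono_AE) (auto elim!: eventually_mono intro!: mult_right_mono)
  finally show ?thesis .
qed

lemma riesz_convolution_shift:
  fixes x z :: "'a::euclidean_space"
  assumes "0 < a" "0 < b" "a + b < real DIM('a)" "x \<noteq> z"
  shows "(\<integral>\<^sup>+y. ennreal (riesz a (x - y) * riesz b (y - z)) \<partial>lborel) = ennreal (riesz (a + b) (x - z))"
proof -
  have "(\<integral>\<^sup>+y. ennreal (riesz a (x - y) * riesz b (y - z)) \<partial>lborel)
      = (\<integral>\<^sup>+y. ennreal (riesz a (x - (z + y)) * riesz b (z + y - z)) \<partial>lborel)"
    by (rule nn_integral_translate[symmetric]) measurable
  also have "\<dots> = (\<integral>\<^sup>+y. ennreal (riesz a ((x - z) - y) * riesz b y) \<partial>lborel)"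
    by (simp add: algebra_simps)
  also have "\<dots> = ennreal (riesz (a + b) (x - z))"
    using assms by (intro riesz_convolution) auto
  finally show ?thesis .
qed

text \<open>Conjugated by the weights, the operator has the kernel
  \<open>norm x powr (- \<beta> / 2) * riesz ((\<beta> - \<alpha>) / 2) (x - y) * norm y powr (\<alpha> / 2)\<close>, which is homogeneous of
  degree \<open>- n\<close>. Hence \<open>norm y powr (- n / 2)\<close> is a common eigenfunction of it and of its transpose, and the
  Schur test with this function yields the sharp constant. Undoing the conjugation turns the
  test function into a multiple of \<open>riesz ((n + \<alpha>) / 2)\<close>, so that the semigroup law evaluates both
  integrals.\<close>

theorem stein_weiss_bound:
  fixes g :: "'a::euclidean_space \<Rightarrow> ennreal"
  defines "n \<equiv> real DIM('a)"
  assumes \<alpha>: "0 < \<alpha>" and \<alpha>\<beta>: "\<alpha> < \<beta>" and \<beta>: "\<beta> < n"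
    and g [measurable]: "g \<in> borel_measurable borel"
  shows "(\<integral>\<^sup>+x. ennreal (norm x powr (- \<beta>)) *
             (\<integral>\<^sup>+y. ennreal (riesz ((\<beta> - \<alpha>) / 2) (x - y)) * g y \<partial>lborel)\<^sup>2 \<partial>lborel)
       \<le> ennreal ((riesz_const DIM('a) ((n + \<beta>) / 2) / riesz_const DIM('a) ((n + \<alpha>) / 2))\<^sup>2) *
           (\<integral>\<^sup>+y. ennreal (norm y powr (- \<alpha>)) * (g y)\<^sup>2 \<partial>lborel)"
proof -
  define r where "r = riesz_const DIM('a)"
  define A B where "A = r ((n + \<alpha>) / 2)" and "B = r ((n + \<beta>) / 2)"
  have pos: "A > 0" "B > 0"
    using \<alpha> \<alpha>\<beta> \<beta> by (auto simp: A_def B_def r_def n_def intro!: riesz_const_pos)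
  have refl: "r ((n - c) / 2) = 1 / r ((n + c) / 2)" if "0 < c" "c < n" for c
  proof -
    have "r (n - (n + c) / 2) * r ((n + c) / 2) = 1"
      unfolding r_def n_def using that by (intro riesz_const_reflect) (auto simp: n_def)
    moreover have "n - (n + c) / 2 = (n - c) / 2" by (simp add: field_simps)
    ultimately show ?thesis by (metis nonzero_eq_divide_eq mult_zero_right zero_neq_one)
  qed
  have ws: "norm x powr (- \<beta>) * riesz ((n + \<beta>) / 2) x = B\<^sup>2 * riesz ((n - \<beta>) / 2) x" for x :: 'a
  proof -
    have "norm x powr (- \<beta>) * norm x powr ((n + \<beta>) / 2 - n) = norm x powr ((n - \<beta>) / 2 - n)"
      unfolding powr_add[symmetric] by (simp add: field_simps)
    then show ?thesis
      using pos refl[of \<beta>] \<alpha> \<alpha>\<beta> \<beta>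
      by (simp add: riesz_def r_def[symmetric] n_def[symmetric] B_def[symmetric] power2_eq_square)
  qed
  have "(\<integral>\<^sup>+x. ennreal (norm x powr (- \<beta>)) *
             (\<integral>\<^sup>+y. ennreal (riesz ((\<beta> - \<alpha>) / 2) (x - y)) * g y \<partial>lborel)\<^sup>2 \<partial>lborel)
      \<le> (\<integral>\<^sup>+y. ennreal (B\<^sup>2 * riesz ((n - \<alpha>) / 2) y) *
             ((g y)\<^sup>2 * ennreal (1 / riesz ((n + \<alpha>) / 2) y)) \<partial>lborel)"
  proof (rule schur_test[where s = "\<lambda>x. ennreal (riesz ((n + \<beta>) / 2) x)"])
    show "pair_sigma_finite lborel (lborel :: 'a measure)" ..
    show "AE y in lborel. 0 < riesz ((n + \<alpha>) / 2) (y::'a)"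
      using AE_lborel_singleton[of 0] pos
      by (auto elim!: eventually_mono simp: riesz_def r_def[symmetric] A_def)
    show "AE x in lborel. (\<integral>\<^sup>+y. ennreal (riesz ((\<beta> - \<alpha>) / 2) (x - y)) * ennreal (riesz ((n + \<alpha>) / 2) y) \<partial>lborel)
        \<le> ennreal (riesz ((n + \<beta>) / 2) (x::'a))"
      using AE_lborel_singleton[of 0]
    proof eventually_elim
      case (elim x)
      have "(\<integral>\<^sup>+y. ennreal (riesz ((\<beta> - \<alpha>) / 2) (x - y) * riesz ((n + \<alpha>) / 2) y) \<partial>lborel)
          = ennreal (riesz ((\<beta> - \<alpha>) / 2 + (n + \<alpha>) / 2) x)"
        using \<alpha> \<alpha>\<beta> \<beta> elim by (intro riesz_convolution) (auto simp: n_def field_simps)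
      also have "(\<beta> - \<alpha>) / 2 + (n + \<alpha>) / 2 = (n + \<beta>) / 2" by (simp add: field_simps)
      finally show ?case
        using \<alpha> \<alpha>\<beta> \<beta> by (simp add: ennreal_mult'' n_def)
    qed
    show "AE y in lborel. (\<integral>\<^sup>+x. ennreal (norm x powr (- \<beta>)) * ennreal (riesz ((n + \<beta>) / 2) x) *
        ennreal (riesz ((\<beta> - \<alpha>) / 2) (x - y)) \<partial>lborel) \<le> ennreal (B\<^sup>2 * riesz ((n - \<alpha>) / 2) (y::'a))"
      using AE_lborel_singleton[of 0]
    proof eventually_elim
      case (elim y)
      have "(\<integral>\<^sup>+x. ennreal (norm x powr (- \<beta>)) * ennreal (riesz ((n + \<beta>) / 2) x) *
              ennreal (riesz ((\<beta> - \<alpha>) / 2) (x - y)) \<partial>lborel)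
          = (\<integral>\<^sup>+x. ennreal (B\<^sup>2) * ennreal (riesz ((\<beta> - \<alpha>) / 2) (y - x) * riesz ((n - \<beta>) / 2) x) \<partial>lborel)"
      proof (intro nn_integral_cong)
        fix x :: 'a
        have nonneg: "0 \<le> riesz ((\<beta> - \<alpha>) / 2) (x - y)"
          using \<alpha> \<alpha>\<beta> \<beta> by (intro riesz_nonneg) (auto simp: n_def)
        have sym: "riesz ((\<beta> - \<alpha>) / 2) (y - x) = riesz ((\<beta> - \<alpha>) / 2) (x - y)"
          using riesz_minus[of _ "x - y"] by simp
        have "ennreal (norm x powr (- \<beta>)) * ennreal (riesz ((n + \<beta>) / 2) x) *
              ennreal (riesz ((\<beta> - \<alpha>) / 2) (x - y))
            = ennreal (norm x powr (- \<beta>) * riesz ((n + \<beta>) / 2) x * riesz ((\<beta> - \<alpha>) / 2) (x - y))"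
          using nonneg by (simp add: ennreal_mult' ennreal_mult'')
        then show "ennreal (norm x powr (- \<beta>)) * ennreal (riesz ((n + \<beta>) / 2) x) *
              ennreal (riesz ((\<beta> - \<alpha>) / 2) (x - y))
            = ennreal (B\<^sup>2) * ennreal (riesz ((\<beta> - \<alpha>) / 2) (y - x) * riesz ((n - \<beta>) / 2) x)"
          by (simp add: ws sym mult_ac flip: ennreal_mult')
      qed
      also have "\<dots> = ennreal (B\<^sup>2) *
          (\<integral>\<^sup>+x. ennreal (riesz ((\<beta> - \<alpha>) / 2) (y - x) * riesz ((n - \<beta>) / 2) x) \<partial>lborel)"
        by (rule nn_integral_cmult) measurable
      also have "(\<integral>\<^sup>+x. ennreal (riesz ((\<beta> - \<alpha>) / 2) (y - x) * riesz ((n - \<beta>) / 2) x) \<partial>lborel)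
          = ennreal (riesz ((\<beta> - \<alpha>) / 2 + (n - \<beta>) / 2) y)"
        using \<alpha> \<alpha>\<beta> \<beta> elim by (intro riesz_convolution) (auto simp: n_def field_simps)
      also have "(\<beta> - \<alpha>) / 2 + (n - \<beta>) / 2 = (n - \<alpha>) / 2" by (simp add: field_simps)
      finally show ?case by (simp add: ennreal_mult')
    qed
  qed measurable
  also have "\<dots> = (\<integral>\<^sup>+y. ennreal ((B / A)\<^sup>2) * (ennreal (norm y powr (- \<alpha>)) * (g y)\<^sup>2) \<partial>lborel)"
  proof (rule nn_integral_cong_AE)
    show "AE y in lborel. ennreal (B\<^sup>2 * riesz ((n - \<alpha>) / 2) y) * ((g y)\<^sup>2 * ennreal (1 / riesz ((n + \<alpha>) / 2) y))
        = ennreal ((B / A)\<^sup>2) * (ennreal (norm y powr (- \<alpha>)) * (g y)\<^sup>2)"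
      using AE_lborel_singleton[of 0]
    proof eventually_elim
      case (elim y)
      have "B\<^sup>2 * riesz ((n - \<alpha>) / 2) y * (1 / riesz ((n + \<alpha>) / 2) y) = (B / A)\<^sup>2 * norm y powr (- \<alpha>)"
      proof -
        have "norm y powr ((n - \<alpha>) / 2 - n) = norm y powr (- \<alpha>) * norm y powr ((n + \<alpha>) / 2 - n)"
          unfolding powr_add[symmetric] by (simp add: field_simps)
        then show ?thesis
          using elim pos refl[of \<alpha>] \<alpha> \<alpha>\<beta> \<beta>
          by (simp add: riesz_def r_def[symmetric] n_def[symmetric] A_def[symmetric] power2_eq_square)
      qed
      moreover have "0 \<le> 1 / riesz ((n + \<alpha>) / 2) y"
        using \<alpha> \<alpha>\<beta> \<beta> by (simp add: n_def)
      ultimately have "ennreal (B\<^sup>2 * riesz ((n - \<alpha>) / 2) y) * ennreal (1 / riesz ((n + \<alpha>) / 2) y)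
          = ennreal ((B / A)\<^sup>2) * ennreal (norm y powr (- \<alpha>))"
        by (metis ennreal_mult' ennreal_mult'' zero_le_power2)
      then show ?case by (simp add: mult_ac)
    qed
  qed
  also have "\<dots> = ennreal ((B / A)\<^sup>2) * (\<integral>\<^sup>+y. ennreal (norm y powr (- \<alpha>)) * (g y)\<^sup>2 \<partial>lborel)"
    by (rule nn_integral_cmult) measurable
  finally show ?thesis by (simp add: A_def B_def r_def)
qed

section \<open>Riesz potentials of increasing order\<close>

definition riesz_potential :: "real \<Rightarrow> ('a::euclidean_space \<Rightarrow> complex) \<Rightarrow> 'a \<Rightarrow> complex" where
  "riesz_potential a F x = (LINT y|lborel. of_real (riesz a (x - y)) * F y)"

lemma riesz_potential_measurable [measurable]:
  assumes [measurable]: "F \<in> borel_measurable borel"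
  shows "riesz_potential a F \<in> borel_measurable borel"
  unfolding riesz_potential_def by measurable

text \<open>By the semigroup law and Fubini's theorem, the potential of order \<open>a + b\<close> is the potential of
  order \<open>a\<close> of the one of order \<open>b\<close>. At a point where the integral of order \<open>a + b\<close> does not converge
  absolutely, its value is 0 by convention and the bound is trivial.\<close>

lemma riesz_potential_domination:
  fixes F :: "'a::euclidean_space \<Rightarrow> complex"
  assumes a: "0 < a" and b: "0 < b" and ab: "a + b < real DIM('a)"
    and F [measurable]: "F \<in> borel_measurable borel"
  shows "ennreal (norm (riesz_potential (a + b) F x))
       \<le> (\<integral>\<^sup>+y. ennreal (riesz a (x - y)) * ennreal (norm (riesz_potential b F y)) \<partial>lborel)"
proof (cases "integrable lborel (\<lambda>z. of_real (riesz (a + b) (x - z)) * F z)")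
  case False
  then show ?thesis
    by (simp add: riesz_potential_def not_integrable_integral_eq)
next
  case True
  define H where "H = (\<lambda>(z, y). of_real (riesz a (x - y) * riesz b (y - z)) * F z)"
  have H_measurable [measurable]: "H \<in> borel_measurable (lborel \<Otimes>\<^sub>M lborel)"
    unfolding H_def by measurable
  have nonneg: "0 \<le> riesz a y" "0 \<le> riesz b y" "0 \<le> riesz (a + b) y" for y :: 'a
    using a b ab by auto
  have inner: "(\<integral>\<^sup>+y. ennreal (riesz a (x - y) * riesz b (y - z)) \<partial>lborel) = ennreal (riesz (a + b) (x - z))"
    if "z \<noteq> x" for z
    using that by (intro riesz_convolution_shift a b ab) auto
  have "(\<integral>\<^sup>+p. ennreal (norm (H p)) \<partial>(lborel \<Otimes>\<^sub>M lborel))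
      = (\<integral>\<^sup>+z. \<integral>\<^sup>+y. ennreal (norm (H (z, y))) \<partial>lborel \<partial>lborel)"
    by (rule lborel.nn_integral_fst[symmetric]) measurable
  also have "\<dots> = (\<integral>\<^sup>+z. ennreal (norm (of_real (riesz (a + b) (x - z)) * F z)) \<partial>lborel)"
  proof (rule nn_integral_cong_AE)
    show "AE z in lborel. (\<integral>\<^sup>+y. ennreal (norm (H (z, y))) \<partial>lborel)
        = ennreal (norm (of_real (riesz (a + b) (x - z)) * F z))"
      using AE_lborel_singleton[of x]
    proof eventually_elim
      case (elim z)
      have "(\<integral>\<^sup>+y. ennreal (norm (H (z, y))) \<partial>lborel)
          = (\<integral>\<^sup>+y. ennreal (riesz a (x - y) * riesz b (y - z)) * ennreal (norm (F z)) \<partial>lborel)"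
        by (intro nn_integral_cong) (simp add: H_def norm_mult nonneg flip: ennreal_mult'')
      also have "\<dots> = ennreal (riesz (a + b) (x - z)) * ennreal (norm (F z))"
        by (subst nn_integral_multc) (auto simp: inner[OF elim])
      finally show ?case
        by (simp add: norm_mult nonneg flip: ennreal_mult'')
    qed
  qed
  also have "\<dots> < \<infinity>"
    using True by (simp add: integrable_iff_bounded)
  finally have H: "integrable (lborel \<Otimes>\<^sub>M lborel) H"
    by (simp add: integrable_iff_bounded)
  have "riesz_potential (a + b) F x = (LINT z|lborel. LINT y|lborel. H (z, y))"
    unfolding riesz_potential_def
  proof (rule integral_cong_AE)
    show "AE z in lborel. of_real (riesz (a + b) (x - z)) * F z = (LINT y|lborel. H (z, y))"
      using AE_lborel_singleton[of x]
    proof eventually_elim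
      case (elim z)
      have "(LINT y|lborel. riesz a (x - y) * riesz b (y - z)) = riesz (a + b) (x - z)"
        using inner[OF elim] by (subst integral_eq_nn_integral) (auto simp: nonneg)
      moreover have "(LINT y|lborel. H (z, y))
          = of_real (LINT y|lborel. riesz a (x - y) * riesz b (y - z)) * F z"
        unfolding H_def prod.case integral_mult_left_zero integral_complex_of_real ..
      ultimately show ?case by simp
    qed
  qed measurable
  also have "\<dots> = (LINT y|lborel. LINT z|lborel. H (z, y))"
    using lborel_pair.Fubini_integral[of "\<lambda>y z. H (z, y)"] lborel_pair.integrable_product_swap[OF H]
    by (simp add: case_prod_unfold)
  also have "\<dots> = (LINT y|lborel. of_real (riesz a (x - y)) * riesz_potential b F y)"
    unfolding riesz_potential_def
    by (simp add: H_def mult.assoc flip: integral_mult_right_zero)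
  finally have eq: "riesz_potential (a + b) F x = (LINT y|lborel. of_real (riesz a (x - y)) * riesz_potential b F y)" .
  have "ennreal (norm (riesz_potential (a + b) F x))
      \<le> (\<integral>\<^sup>+y. ennreal (norm (of_real (riesz a (x - y)) * riesz_potential b F y)) \<partial>lborel)"
    unfolding eq
    by (cases "integrable lborel (\<lambda>y. of_real (riesz a (x - y)) * riesz_potential b F y)")
      (auto intro: integral_norm_bound_ennreal simp: not_integrable_integral_eq)
  also have "\<dots> = (\<integral>\<^sup>+y. ennreal (riesz a (x - y)) * ennreal (norm (riesz_potential b F y)) \<partial>lborel)"
    by (simp add: norm_mult nonneg ennreal_mult')
  finally show ?thesis .
qed

lemma borel_representative:
  fixes f :: "'a::euclidean_space \<Rightarrow> complex"
  assumes "f \<in> borel_measurable lebesgue"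
  obtains F where "F \<in> borel_measurable borel" "AE x in lebesgue. f x = F x"
proof -
  have "(\<lambda>x. Re (f x)) \<in> borel_measurable lebesgue" "(\<lambda>x. Im (f x)) \<in> borel_measurable lebesgue"
    using assms by measurable
  then obtain g h where gh [measurable]: "g \<in> borel_measurable borel" "h \<in> borel_measurable borel"
    and ae: "AE x in lborel. Re (f x) = g x" "AE x in lborel. Im (f x) = h x"
    by (auto dest!: completion_ex_borel_measurable_real)
  show ?thesis
  proof
    show "(\<lambda>x. Complex (g x) (h x)) \<in> borel_measurable borel"
      unfolding Complex_eq by measurable
    have "AE x in lborel. f x = Complex (g x) (h x)"
      using ae by eventually_elim (simp add: complex_eq_iff)
    then show "AE x in lebesgue. f x = Complex (g x) (h x)"
      by (rule AE_completion)
  qed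
qed

section \<open>Monotonicity\<close>

lemma d_const_eq: "d_const n \<alpha> = (riesz_const n (\<alpha> / 2))\<^sup>2"
proof -
  have "(pi powr (\<alpha> / 2 - real n / 2))\<^sup>2 = pi powr (- (real n - \<alpha>))"
    by (simp add: power2_eq_square flip: powr_add)
  then show ?thesis
    by (simp add: d_const_def riesz_const_def power_mult_distrib power_divide diff_divide_distrib)
qed

lemma C_const_eq: "C_const n \<alpha> = (riesz_const n ((real n + \<alpha>) / 2))\<^sup>2"
proof -
  have "(pi powr ((real n + \<alpha>) / 2 - real n / 2))\<^sup>2 = pi powr \<alpha>"
    by (simp add: power2_eq_square add_divide_distrib flip: powr_add)
  moreover have "(real n - (real n + \<alpha>) / 2) / 2 = (real n - \<alpha>) / 4"
    by (simp add: field_simps)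
  moreover have "(real n + \<alpha>) / 2 / 2 = (real n + \<alpha>) / 4"
    by simp
  ultimately show ?thesis
    unfolding C_const_def riesz_const_def times_divide_eq_right[symmetric] power_mult_distrib
    by (simp only:)
qed

text \<open>The factor \<open>d_const\<close> is absorbed into the kernel, where it normalises it to \<open>riesz (\<alpha> / 2)\<close>. Replacing
  \<open>f\<close> by a Borel representative allows product measures to be formed from \<open>lborel\<close>.\<close>

lemma pitt_quantity_eq:
  fixes f F :: "real^'n \<Rightarrow> complex"
  assumes \<alpha>: "0 < \<alpha>" "\<alpha> < real CARD('n)"
    and f [measurable]: "f \<in> borel_measurable lebesgue"
    and F [measurable]: "F \<in> borel_measurable borel" and ae: "AE x in lebesgue. f x = F x"
  shows "pitt_quantity f \<alpha> = ennreal (1 / (riesz_const CARD('n) ((real CARD('n) + \<alpha>) / 2))\<^sup>2) *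
    (\<integral>\<^sup>+x. ennreal (norm x powr (- \<alpha>)) * (ennreal (norm (riesz_potential (\<alpha> / 2) F x)))\<^sup>2 \<partial>lborel)"
proof -
  define r where "r = riesz_const CARD('n) (\<alpha> / 2)"
  define R where "R = riesz_const CARD('n) ((real CARD('n) + \<alpha>) / 2)"
  have r: "r > 0" using \<alpha> by (auto simp: r_def intro!: riesz_const_pos)
  let ?k = "\<lambda>z::real^'n. norm z powr (- real CARD('n) + \<alpha> / 2)"
  have conv: "riesz_potential (\<alpha> / 2) F x = of_real r * Defs.convolution ?k f x" for x
  proof -
    have "Defs.convolution ?k f x = (LINT y|lebesgue. of_real (?k (x - y)) * F y)"
      unfolding Defs.convolution_def
    proof (rule integral_cong_AE)
      show "(\<lambda>y. complex_of_real (?k (x - y)) * f y) \<in> borel_measurable lebesgue"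
        by (intro borel_measurable_times f measurable_completion) measurable
      show "(\<lambda>y. complex_of_real (?k (x - y)) * F y) \<in> borel_measurable lebesgue"
        by (intro measurable_completion) measurable
      show "AE y in lebesgue. complex_of_real (?k (x - y)) * f y = complex_of_real (?k (x - y)) * F y"
        using ae by eventually_elim simp
    qed
    also have "\<dots> = (LINT y|lborel. of_real (?k (x - y)) * F y)"
      by (rule integral_completion) measurable
    finally have "of_real r * Defs.convolution ?k f x = (LINT y|lborel. of_real r * (of_real (?k (x - y)) * F y))"
      by simp
    then show ?thesis
      by (auto simp: riesz_potential_def riesz_def r_def mult.assoc)
  qed
  have "pitt_quantity f \<alpha> = ennreal (r\<^sup>2 / R\<^sup>2) *
      (\<integral>\<^sup>+x. ennreal (norm x powr (- \<alpha>) * (norm (Defs.convolution ?k f x))\<^sup>2) \<partial>lborel)"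
    by (simp add: pitt_quantity_def d_const_eq C_const_eq r_def R_def nn_integral_completion)
  also have "\<dots> = ennreal (1 / R\<^sup>2) * (ennreal (r\<^sup>2) *
      (\<integral>\<^sup>+x. ennreal (norm x powr (- \<alpha>) * (norm (Defs.convolution ?k f x))\<^sup>2) \<partial>lborel))"
    by (simp add: mult.assoc[symmetric] flip: ennreal_mult')
  also have "ennreal (r\<^sup>2) * (\<integral>\<^sup>+x. ennreal (norm x powr (- \<alpha>) * (norm (Defs.convolution ?k f x))\<^sup>2) \<partial>lborel)
      = (\<integral>\<^sup>+x. ennreal (r\<^sup>2) * ennreal (norm x powr (- \<alpha>) * (norm (Defs.convolution ?k f x))\<^sup>2) \<partial>lborel)"
  proof (rule nn_integral_cmult[symmetric])
    have "Defs.convolution ?k f = (\<lambda>x. riesz_potential (\<alpha> / 2) F x / of_real r)"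
      using r by (auto simp: conv)
    then show "(\<lambda>x. ennreal (norm x powr (- \<alpha>) * (norm (Defs.convolution ?k f x))\<^sup>2)) \<in> borel_measurable lborel"
      by simp
  qed
  also have "\<dots> = (\<integral>\<^sup>+x. ennreal (norm x powr (- \<alpha>)) * (ennreal (norm (riesz_potential (\<alpha> / 2) F x)))\<^sup>2 \<partial>lborel)"
    using r by (intro nn_integral_cong)
      (simp add: conv norm_mult ennreal_power power_mult_distrib mult_ac flip: ennreal_mult')
  finally show ?thesis by (simp add: R_def)
qed

theorem mainTheorem3:
  fixes f :: "real^'n \<Rightarrow> complex"
  assumes "square_integrable f"
  shows "antimono_on {0<..<min 2 (real CARD('n))} (\<lambda>\<alpha>. pitt_quantity f \<alpha>)"
proof (rule monotone_onI)
  fix \<alpha> \<beta> :: real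
  assume "\<alpha> \<in> {0<..<min 2 (real CARD('n))}" "\<beta> \<in> {0<..<min 2 (real CARD('n))}" "\<alpha> \<le> \<beta>"
  then have ab: "0 < \<alpha>" "\<beta> < real CARD('n)" "\<alpha> \<le> \<beta>" by auto
  show "pitt_quantity f \<beta> \<le> pitt_quantity f \<alpha>"
  proof (cases "\<alpha> = \<beta>")
    case False
    with ab have lt: "\<alpha> < \<beta>" by simp
    have f: "f \<in> borel_measurable lebesgue"
      using assms by (simp add: square_integrable_def)
    then obtain F where F [measurable]: "F \<in> borel_measurable borel"
      and ae: "AE x in lebesgue. f x = F x"
      by (rule borel_representative)
    define R where "R = (\<lambda>\<alpha>. riesz_const CARD('n) ((real CARD('n) + \<alpha>) / 2))"
    define N where "N = (\<lambda>\<alpha> x. ennreal (norm (riesz_potential (\<alpha> / 2) F x)))"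
    define I where "I = (\<lambda>\<alpha>. \<integral>\<^sup>+x. ennreal (norm x powr (- \<alpha>)) * (N \<alpha> x)\<^sup>2 \<partial>lborel)"
    have N_measurable: "N c \<in> borel_measurable borel" for c
      unfolding N_def by measurable
    have R: "R \<alpha> > 0" "R \<beta> > 0"
      using ab lt by (auto simp: R_def intro!: riesz_const_pos)
    have "I \<beta> \<le> (\<integral>\<^sup>+x. ennreal (norm x powr (- \<beta>)) *
        (\<integral>\<^sup>+y. ennreal (riesz ((\<beta> - \<alpha>) / 2) (x - y)) * N \<alpha> y \<partial>lborel)\<^sup>2 \<partial>lborel)"
      unfolding I_def
    proof (intro nn_integral_mono mult_left_mono power_mono)
      fix x :: "real^'n"
      have "(\<beta> - \<alpha>) / 2 + \<alpha> / 2 = \<beta> / 2" by (simp add: field_simps)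
      from riesz_potential_domination[of "(\<beta> - \<alpha>) / 2" "\<alpha> / 2" F x, unfolded this] ab lt
      show "N \<beta> x \<le> (\<integral>\<^sup>+y. ennreal (riesz ((\<beta> - \<alpha>) / 2) (x - y)) * N \<alpha> y \<partial>lborel)"
        by (simp add: N_def)
    qed auto
    also have "\<dots> \<le> ennreal ((R \<beta> / R \<alpha>)\<^sup>2) * I \<alpha>"
      using stein_weiss_bound[OF \<open>0 < \<alpha>\<close> lt _ N_measurable[of \<alpha>]] ab
      by (simp add: R_def I_def)
    finally have "ennreal (1 / (R \<beta>)\<^sup>2) * I \<beta> \<le> ennreal (1 / (R \<beta>)\<^sup>2) * (ennreal ((R \<beta> / R \<alpha>)\<^sup>2) * I \<alpha>)"
      by (rule mult_left_mono) simp
    also have "\<dots> = ennreal (1 / (R \<alpha>)\<^sup>2) * I \<alpha>"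
      using R by (simp add: mult.assoc[symmetric] power_divide flip: ennreal_mult')
    finally show ?thesis
      using ab lt by (simp add: pitt_quantity_eq[OF _ _ f F ae] R_def I_def N_def)
  qed simp
qed

end
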